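(* With $\beta=q+q^{-1}$, we have \[ A^{*3}A-(\beta+1)A^{*2}AA^*+(\beta+1)A^*AA^{*2}-AA^{*3}=0 . \]
   Context: Let $q$ be a prime power, $GF(q)$ the field with $q$ elements, $N\ge 1$ an integer, and $\mathbf V$ an $N$-dimensional vector space over $GF(q)$. Let $X$ be the set of all subspaces of $\mathbf V$, ordered by inclusion (the projective geometry $L_N(q)$). For $y,z\in X$, $y$ covers $z$ means $z\subseteq y$ and $\dim y-\dim z=1$. ${\rm Mat}_X(\mathbb C)$ is the algebra of complex matrices with rows and columns indexed by $X$. $A^*\in{\rm Mat}_X(\mathbb C)$ is the diagonal matrix with $(y,y)$-entry $q^{-\dim y}$; $A^{*k}$ denotes $(A^* )^k$. Fix a real number $\varphi>0$. The matrix $A\in{\rm Mat}_X(\mathbb C)$ has $(y,z)$-entry $1$ if $y$ covers $z$; $\varphi q^{\dim y}$ if $z$ covers $y$; $\frac{\varphi-1}{q-1}q^{\dim y}$ if $y=z$; and $0$ otherwise. *)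

theory Defs
  imports Complex_Main "Jordan_Normal_Form.Matrix"
begin

text \<open>
  The ambient vector space is the whole type \<open>'v\<close>, with scalar multiplication \<open>scale\<close>
  over the finite field \<open>'k\<close>.
\<close>

definition subspaces :: "('k::field \<Rightarrow> 'v::ab_group_add \<Rightarrow> 'v) \<Rightarrow> 'v set set" where
  "subspaces scale = {S. module.subspace scale S}"

definition covers :: "('k::field \<Rightarrow> 'v::ab_group_add \<Rightarrow> 'v) \<Rightarrow> 'v set \<Rightarrow> 'v set \<Rightarrow> bool" where
  "covers scale y z \<longleftrightarrow>
     z \<subseteq> y \<and> vector_space.dim scale y = vector_space.dim scale z + 1"

definition dual_entry ::
  "('k::field \<Rightarrow> 'v::ab_group_add \<Rightarrow> 'v) \<Rightarrow> nat \<Rightarrow> 'v set \<Rightarrow> 'v set \<Rightarrow> complex" where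
  "dual_entry scale q y z =
     (if y = z then 1 / of_nat q ^ vector_space.dim scale y else 0)"

definition adj_entry ::
  "('k::field \<Rightarrow> 'v::ab_group_add \<Rightarrow> 'v) \<Rightarrow> nat \<Rightarrow> real \<Rightarrow> 'v set \<Rightarrow> 'v set \<Rightarrow> complex" where
  "adj_entry scale q \<phi> y z =
     (if covers scale y z then 1
      else if covers scale z y then of_real \<phi> * of_nat q ^ vector_space.dim scale y
      else if y = z then
        (of_real \<phi> - 1) / (of_nat q - 1) * of_nat q ^ vector_space.dim scale y
      else 0)"

text \<open>
  A matrix with rows and columns indexed by a finite set \<open>X\<close> is represented through an
  enumeration \<open>xs\<close> of \<open>X\<close> without repetitions: index \<open>i\<close> stands for the element \<open>xs ! i\<close>.
\<close>

definition mat_indexed :: "'x list \<Rightarrow> ('x \<Rightarrow> 'x \<Rightarrow> complex) \<Rightarrow> complex mat" where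
  "mat_indexed xs f = mat (length xs) (length xs) (\<lambda>(i, j). f (xs ! i) (xs ! j))"

text \<open>Such an enumeration of the subspaces always exists.\<close>

lemma ex_enumeration_subspaces:
  fixes scale :: "'k::{field,finite} \<Rightarrow> 'v::ab_group_add \<Rightarrow> 'v"
  assumes "vector_space scale" and "vector_space.dim scale UNIV \<ge> 1"
  shows "\<exists>xs. distinct xs \<and> set xs = subspaces scale"
proof -
  interpret vector_space scale by fact
  obtain B where B0: "independent B" "UNIV \<subseteq> span B" "card B = dim UNIV"
    by (rule basis_exists)
  then have B: "span B = UNIV" "card B = dim UNIV" by auto
  with assms(2) have fin: "finite B" by (intro card_ge_0_finite) simp
  have eq: "(UNIV :: 'v set) = (\<lambda>u. \<Sum>v\<in>B. scale (u v) v) ` (B \<rightarrow>\<^sub>E UNIV)"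
  proof -
    have "x \<in> (\<lambda>u. \<Sum>v\<in>B. scale (u v) v) ` (B \<rightarrow>\<^sub>E UNIV)" for x
    proof -
      obtain u where "x = (\<Sum>v\<in>B. scale (u v) v)"
        using B(1) span_finite[OF fin] by auto
      then have "x = (\<Sum>v\<in>B. scale (restrict u B v) v)" by simp
      then show ?thesis by (intro image_eqI[of _ _ "restrict u B"]) auto
    qed
    then show ?thesis by blast
  qed
  have "finite (B \<rightarrow>\<^sub>E (UNIV :: 'k set))" using fin by (intro finite_PiE) auto
  then have "finite (UNIV :: 'v set)" by (subst eq) (rule finite_imageI)
  then have "finite (Pow (UNIV :: 'v set))" by (simp only: finite_Pow_iff)
  then have "finite (subspaces scale)" by (rule rev_finite_subset) auto
  then show ?thesis using finite_distinct_list by blast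
qed

end

theory Submission
  imports Defs
begin

text \<open>
  Since \<open>A*\<close> is diagonal, the \<open>(y, z)\<close>-entry of the left-hand side is
  \<open>A(y, z) (s - t) (s - q t) (s - t / q)\<close> with \<open>s = q^(- dim y)\<close> and \<open>t = q^(- dim z)\<close>.
  It vanishes because \<open>A(y, z) \<noteq> 0\<close> forces the dimensions of \<open>y\<close> and \<open>z\<close> to differ by at most \<open>1\<close>.
\<close>

lemma mat_diag_pow: "mat_diag n f ^\<^sub>m k = mat_diag n (\<lambda>i. f i ^ k)"
  by (induction k) (simp_all add: carrier_matD[OF mat_diag_dim] power_commutes)

lemma mat_indexed_diag:
  assumes "distinct xs"
  shows "mat_indexed xs (\<lambda>y z. if y = z then f y else 0) = mat_diag (length xs) (\<lambda>i. f (xs ! i))"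
  using assms by (intro eq_matI) (auto simp: mat_indexed_def mat_diag_def nth_eq_iff_index_eq)

text \<open>Homogeneous Vieta for the roots \<open>1\<close>, \<open>q\<close>, \<open>1 / q\<close>
  of \<open>s / t\<close>: their product is 1, so their sum and the sum of their pairwise products
  are both \<open>q + 1 / q + 1\<close>.\<close>

lemma cubic_factorization:
  fixes q s t :: complex
  assumes "q \<noteq> 0"
  shows "s ^ 3 - (q + 1 / q + 1) * (s ^ 2 * t) + (q + 1 / q + 1) * (s * t ^ 2) - t ^ 3
           = (s - t) * (s - q * t) * (s - t / q)"
  using assms by (simp add: field_simps power2_eq_square power3_eq_cube)

text \<open>Each way for the entry to be nonzero kills one factor: \<open>s = t / q\<close> if
  \<open>y\<close> covers \<open>z\<close>, \<open>s = q t\<close> if \<open>z\<close> covers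
  \<open>y\<close>, and \<open>s = t\<close> if \<open>y = z\<close>.\<close>

lemma adj_entry_times_cubic:
  assumes "q \<noteq> 0"
    and s: "s = 1 / of_nat q ^ vector_space.dim scale y"
    and t: "t = 1 / of_nat q ^ vector_space.dim scale z"
  shows "adj_entry scale q \<phi> y z * ((s - t) * (s - of_nat q * t) * (s - t / of_nat q)) = 0"
proof -
  consider "covers scale y z" | "covers scale z y" | "y = z" | "adj_entry scale q \<phi> y z = 0"
    unfolding adj_entry_def by presburger
  then show ?thesis
    by cases (use \<open>q \<noteq> 0\<close> in \<open>auto simp: s t covers_def\<close>)
qed

theorem proposition8p4:
  fixes scale :: "'k::{field,finite} \<Rightarrow> 'v::ab_group_add \<Rightarrow> 'v"
    and q N n :: nat
    and \<phi> :: real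
    and \<beta> :: complex
    and xs :: "'v set list"
    and A As :: "complex mat"
  assumes "vector_space scale"
    and "q = card (UNIV :: 'k set)"
    and "N \<ge> 1"
    and "vector_space.dim scale UNIV = N"
    and "\<phi> > 0"
    and "distinct xs" and "set xs = subspaces scale" and "n = length xs"
    and "As = mat_indexed xs (dual_entry scale q)"
    and "A = mat_indexed xs (adj_entry scale q \<phi>)"
    and "\<beta> = of_nat q + 1 / of_nat q"
  shows "As ^\<^sub>m 3 * A - (\<beta> + 1) \<cdot>\<^sub>m (As ^\<^sub>m 2 * A * As)
           + (\<beta> + 1) \<cdot>\<^sub>m (As * A * As ^\<^sub>m 2) - A * As ^\<^sub>m 3
         = 0\<^sub>m n n"
proof -
  have "q \<noteq> 0"
    using assms(2) by simp
  define d where "d y = (1 / of_nat q ^ vector_space.dim scale y :: complex)" for y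
  have As: "As = mat_diag n (\<lambda>i. d (xs ! i))"
  proof -
    have "dual_entry scale q = (\<lambda>y z. if y = z then d y else 0)"
      by (intro ext) (simp add: dual_entry_def d_def)
    then show ?thesis
      using mat_indexed_diag[OF assms(6), of d] by (simp add: assms(8,9))
  qed
  have A: "A \<in> carrier_mat n n"
    by (simp add: assms(8,10) mat_indexed_def)
  \<comment> \<open>A product \<open>As ^\<^sub>m a * A * As ^\<^sub>m b\<close> scales the entry of
    \<open>A\<close> at \<open>(i, j)\<close> by
    \<open>d (xs ! i) ^ a * d (xs ! j) ^ b\<close>.\<close>
  have entry: "A $$ (i, j) * (d (xs ! i) ^ 3 - (\<beta> + 1) * (d (xs ! i) ^ 2 * d (xs ! j))
      + (\<beta> + 1) * (d (xs ! i) * d (xs ! j) ^ 2) - d (xs ! j) ^ 3) = 0"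
    if "i < n" "j < n" for i j
    using that \<open>q \<noteq> 0\<close> adj_entry_times_cubic[OF \<open>q \<noteq> 0\<close> d_def d_def]
    by (simp add: assms(8,10,11) mat_indexed_def cubic_factorization)
  have left: "mat_diag n f * A = mat n n (\<lambda>(i, j). f i * A $$ (i, j))" for f
    using A by (rule mat_diag_mult_left)
  \<comment> \<open>Stated for an explicit \<open>mat n n g\<close>, the shape that
    \<open>left\<close> gives to the first product in \<open>As ^\<^sub>m 2 * A * As\<close> and
    \<open>As * A * As ^\<^sub>m 2\<close>.\<close>
  have right: "mat n n g * mat_diag n f = mat n n (\<lambda>(i, j). g (i, j) * f j)" for f g
    by (subst mat_diag_mult_right[of _ n]) auto
  have right': "A * mat_diag n f = mat n n (\<lambda>(i, j). A $$ (i, j) * f j)" for f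
    using A by (rule mat_diag_mult_right)
  show ?thesis
    unfolding As mat_diag_pow left right right'
    by (intro eq_matI) (use entry in \<open>auto simp: algebra_simps\<close>)
qed

end
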